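(* Let $F\in C^2(\mathbb{R}^d\times\mathbb{R}\times\mathbb{R}^d)$, $\delta\in(0,1)$, $\Omega$, $p$, $r$, $B(M)$ and $J_{\lambda,\eta}$ be as in the context, with $\epsilon_0>0$ and $\eta\in(0,1)$. Let $v_{\epsilon_0}$ be a function satisfying $$-\epsilon_0\Delta v_{\epsilon_0}+F(\mathbf{x},v_{\epsilon_0},\nabla v_{\epsilon_0})=0\quad\text{for all }\mathbf{x}\in\mathbb{R}^d,$$ and, for some constant $C_0>0$, $$|v_{\epsilon_0}(\mathbf{x})|<C_0\delta\quad\text{and}\quad|\nabla v_{\epsilon_0}(\mathbf{x})|<C_0\delta\quad\text{for all }\mathbf{x}\in\partial\Omega .$$ Assume that (the restriction to $\Omega$ of) $v_{\epsilon_0}$ belongs to $\overline{B(M)}$ for some large number $M$. Let $\beta,\lambda$ be such that, for some constant $C_1>0$ depending only on $\lambda,\beta,R,r,d,M,F$ and $\epsilon_0$, the inequality $$ \begin{aligned} J_{\lambda,\eta}(u)-J_{\lambda,\eta}(v)-DJ_{\lambda,\eta}(v)(u-v)\ge{}& C_1\int_{\Omega}e^{2\lambda r^{-\beta}}\big[|u-v|^2+|\nabla(u-v)|^2\big]d\mathbf{x}\\ &+C_1\int_{\partial\Omega}\lambda^4e^{2\lambda r^{-\beta}}\big(|u-v|^2+|\nabla(u-v)|^2\big)d\sigma(\mathbf{x})+\eta\|u-v\|^2_{H^p(\Omega)} \end{aligned} $$ holds for all $u,v\in\overline{B(M)}$. Let $v_{\rm min}^{\epsilon_0}$ be the unique minimizer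 of $J_{\lambda,\eta}$ in $\overline{B(M)}$. Then, for some constant $C>0$, $$ \begin{aligned} &\int_{\Omega}e^{2\lambda r^{-\beta}}\big[|v_{\epsilon_0}-v_{\rm min}^{\epsilon_0}|^2+|\nabla(v_{\epsilon_0}-v_{\rm min}^{\epsilon_0})|^2\big]d\mathbf{x}+\int_{\partial\Omega}\lambda^4e^{2\lambda r^{-\beta}}\big(|v_{\epsilon_0}-v_{\rm min}^{\epsilon_0}|^2+|\nabla(v_{\epsilon_0}-v_{\rm min}^{\epsilon_0})|^2\big)d\sigma(\mathbf{x})\\ &\qquad+\eta\|v_{\epsilon_0}-v_{\rm min}^{\epsilon_0}\|^2_{H^p(\Omega)}\le C\Big[\lambda^4\delta^2\int_{\partial\Omega}e^{2\lambda r^{-\beta}}d\sigma(\mathbf{x})+\eta\|v_{\epsilon_0}\|^2_{H^p(\Omega)}\Big]. \end{aligned} $$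
   Context: Let $d\ge1$, $R>0$, $\Omega=(-R,R)^d$, and let $G$ be a bounded domain compactly contained in $\Omega$. Let $\delta\in(0,1)$ and let $\chi_\delta\in C^\infty(\mathbb{R}^d)$ satisfy, for some constant $c>0$: $\chi_\delta>c$ on $G$, $\chi_\delta\in(\delta,c]$ on $\Omega\setminus G$, and $\chi_\delta=\delta$ on $\mathbb{R}^d\setminus\Omega$. Let $H:\mathbb{R}^d\times\mathbb{R}^d\to\mathbb{R}$ satisfy $|H(\mathbf{x},\mathbf{p})|\le K|\mathbf{p}|^k$ for all $\mathbf{x},\mathbf{p}\in\mathbb{R}^d$, for some constants $K,k>0$, and let $\mu>0$ be fixed (the coefficient of $u$ in the Hamilton-Jacobi equation $\mu u+H(\mathbf{x},\nabla u)=0$ on $\mathbb{R}^d$). Define $$F(\mathbf{x},s,\mathbf{p})=\chi_\delta^{2k}(\mathbf{x})\left[\mu\frac{s}{\chi_\delta(\mathbf{x})}+H\!\left(\mathbf{x},\frac{\chi_\delta(\mathbf{x})\mathbf{p}-s\nabla\chi_\delta(\mathbf{x})}{\chi_\delta^2(\mathbf{x})}\right)\right],$$ and assume $F$ is of class $C^2$. Let $\mathbf{x}_0\in\mathbb{R}^d\setminus\Omega$ and $r=r(\mathbf{x})=|\mathbf{x}-\mathbf{x}_0|$ for $\mathbf{x}\in\overline\Omega$. Let $p>\lceil d/2\rceil+2$, so that the $L^2$-based Sobolev space $H^p(\Omega)$ is continuously embedded into $C^2(\overline\Omega)$. For $M>0$, $B(M)=\{v\in H^p(\Omega):\|v\|_{H^p(\Omega)}<M\}$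 and $\overline{B(M)}$ is its closure in $H^p(\Omega)$. For $\epsilon_0>0$ and parameters $\lambda,\beta>0$, $\eta\in(0,1)$, define $$J_{\lambda,\eta}(v)=\int_\Omega e^{2\lambda r^{-\beta}}\big|-\epsilon_0\Delta v+F(\mathbf{x},v,\nabla v)\big|^2d\mathbf{x}+\lambda^4\int_{\partial\Omega}e^{2\lambda r^{-\beta}}\big(|v|^2+|\nabla v|^2\big)d\sigma(\mathbf{x})+\eta\|v\|_{H^p(\Omega)}^2,\quad v\in H^p(\Omega),$$ where $d\sigma$ is surface measure on $\partial\Omega$. $DJ_{\lambda,\eta}(v)$ denotes the Fréchet derivative of $J_{\lambda,\eta}$ at $v$. *)

theory Defs
  imports "HOL-Analysis.Analysis" "HOL-Library.Multiset"
begin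

text \<open>For open \<open>S\<close>, \<open>Ck_closure k S f\<close> says that \<open>f\<close> is of class \<open>C\<^sup>k\<close> up to the closure of \<open>S\<close>:
  all partial derivatives of order at most \<open>k\<close> exist in \<open>S\<close> and extend continuously to
  \<open>closure S\<close>. For \<open>S = UNIV\<close> this is the usual class \<open>C\<^sup>k\<close>. Values of \<open>f\<close> outside \<open>S\<close> are irrelevant.\<close>

primrec Ck_closure :: "nat \<Rightarrow> 'a::euclidean_space set \<Rightarrow> ('a \<Rightarrow> real) \<Rightarrow> bool" where
  "Ck_closure 0 S f \<longleftrightarrow> (\<exists>g. continuous_on (closure S) g \<and> (\<forall>x\<in>S. g x = f x))"
| "Ck_closure (Suc k) S f \<longleftrightarrow>
     (\<exists>g. continuous_on (closure S) g \<and> (\<forall>x\<in>S. g x = f x)) \<and>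
     (\<forall>x\<in>S. f differentiable (at x)) \<and>
     (\<forall>b\<in>Basis. Ck_closure k S (\<lambda>x. frechet_derivative f (at x) b))"

definition smooth :: "('a::euclidean_space \<Rightarrow> real) \<Rightarrow> bool" where
  "smooth f \<longleftrightarrow> (\<forall>k. Ck_closure k UNIV f)"

definition pdiff :: "'n::finite \<Rightarrow> (real^'n \<Rightarrow> real) \<Rightarrow> real^'n \<Rightarrow> real" where
  "pdiff i f x = frechet_derivative f (at x) (axis i 1)"

definition grad :: "(real^'n::finite \<Rightarrow> real) \<Rightarrow> real^'n \<Rightarrow> real^'n" where
  "grad f x = (\<chi> i. pdiff i f x)"

definition laplacian :: "(real^'n::finite \<Rightarrow> real) \<Rightarrow> real^'n \<Rightarrow> real" where
  "laplacian f x = (\<Sum>i\<in>UNIV. pdiff i (pdiff i f) x)"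

definition cube :: "real \<Rightarrow> (real^'n::finite) set" where
  "cube R = {x. \<forall>i. - R < x $ i \<and> x $ i < R}"

text \<open>The boundary of the cube consists of the \<open>2 d\<close> faces \<open>x\<^sub>i = s\<close> with \<open>s \<in> {-R, R}\<close>; each
  of them carries the \<open>(d-1)\<close>-dimensional Lebesgue measure in the remaining coordinates.
  For \<open>d = 1\<close> the product over the empty index set is a point mass, so this becomes
  counting measure on \<open>{-R, R}\<close>.\<close>

definition surface_nn_integral :: "real \<Rightarrow> (real^'n::finite \<Rightarrow> ennreal) \<Rightarrow> ennreal" where
  "surface_nn_integral R f =
     (\<Sum>i\<in>UNIV. \<Sum>s\<in>{- R, R}.
        \<integral>\<^sup>+ y. f (\<chi> j. if j = i then s else y j)
          \<partial>(Pi\<^sub>M (UNIV - {i}) (\<lambda>_. restrict_space lborel {- R..R})))"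

definition test_fun :: "(real^'n::finite) set \<Rightarrow> (real^'n \<Rightarrow> real) set" where
  "test_fun S = {\<phi>. smooth \<phi> \<and> (\<exists>K. compact K \<and> K \<subseteq> S \<and> (\<forall>x. x \<notin> K \<longrightarrow> \<phi> x = 0))}"

definition L2 :: "(real^'n::finite) set \<Rightarrow> (real^'n \<Rightarrow> real) set" where
  "L2 S = {w. w \<in> borel_measurable (lebesgue_on S) \<and> integrable (lebesgue_on S) (\<lambda>x. (w x)\<^sup>2)}"

text \<open>A multi-index is a multiset of coordinates, of order \<open>size \<alpha>\<close>. Any enumeration \<open>is\<close> of it
  gives the same derivative of a test function.\<close>

definition weak_deriv ::
  "(real^'n::finite) set \<Rightarrow> 'n multiset \<Rightarrow> (real^'n \<Rightarrow> real) \<Rightarrow> (real^'n \<Rightarrow> real) \<Rightarrow> bool" where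
  "weak_deriv S \<alpha> v w \<longleftrightarrow>
     (\<forall>\<phi>\<in>test_fun S. \<forall>is. mset is = \<alpha> \<longrightarrow>
        (LINT x|lebesgue_on S. v x * foldr pdiff is \<phi> x)
          = (- 1) ^ size \<alpha> * (LINT x|lebesgue_on S. w x * \<phi> x))"

text \<open>Elements of \<open>H\<^sup>p(S)\<close> are represented by functions on the whole space, of which only the
  values almost everywhere on \<open>S\<close> matter; \<open>Hnorm\<close> is thus a seminorm whose null vectors are the
  functions vanishing almost everywhere on \<open>S\<close>.\<close>

definition Hspace :: "nat \<Rightarrow> (real^'n::finite) set \<Rightarrow> (real^'n \<Rightarrow> real) set" where
  "Hspace p S = {v \<in> L2 S. \<forall>\<alpha>. size \<alpha> \<le> p \<longrightarrow> (\<exists>w\<in>L2 S. weak_deriv S \<alpha> v w)}"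

definition wderiv :: "(real^'n::finite) set \<Rightarrow> 'n multiset \<Rightarrow> (real^'n \<Rightarrow> real) \<Rightarrow> real^'n \<Rightarrow> real" where
  "wderiv S \<alpha> v = (SOME w. w \<in> L2 S \<and> weak_deriv S \<alpha> v w)"

definition Hnorm :: "nat \<Rightarrow> (real^'n::finite) set \<Rightarrow> (real^'n \<Rightarrow> real) \<Rightarrow> real" where
  "Hnorm p S v =
     sqrt (\<Sum>\<alpha>\<in>{\<alpha>. size \<alpha> \<le> p}. LINT x|lebesgue_on S. (wderiv S \<alpha> v x)\<^sup>2)"

definition Hball :: "nat \<Rightarrow> (real^'n::finite) set \<Rightarrow> real \<Rightarrow> (real^'n \<Rightarrow> real) set" where
  "Hball p S M = {v \<in> Hspace p S. Hnorm p S v < M}"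

definition Hclosure ::
  "nat \<Rightarrow> (real^'n::finite) set \<Rightarrow> (real^'n \<Rightarrow> real) set \<Rightarrow> (real^'n \<Rightarrow> real) set" where
  "Hclosure p S A = {v \<in> Hspace p S. \<forall>e>0. \<exists>w\<in>A. Hnorm p S (\<lambda>x. v x - w x) < e}"

text \<open>When \<open>H\<^sup>p(S)\<close> embeds into \<open>C\<^sup>2\<close> up to the closure, an element \<open>v\<close> is identified with its
  \<open>C\<^sup>2\<close> representative; on \<open>S\<close> this determines it uniquely. Boundary values are those of the
  continuous extension.\<close>

definition C2_rep :: "(real^'n::finite) set \<Rightarrow> (real^'n \<Rightarrow> real) \<Rightarrow> real^'n \<Rightarrow> real" where
  "C2_rep S v = (SOME u. Ck_closure 2 S u \<and> (AE x in lebesgue_on S. u x = v x))"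

definition bdry_value :: "(real^'n::finite) set \<Rightarrow> (real^'n \<Rightarrow> 'b::t2_space) \<Rightarrow> real^'n \<Rightarrow> 'b" where
  "bdry_value S g x = Lim (at x within S) g"

text \<open>Frechet derivative on \<open>H\<^sup>p(S)\<close> of a functional with values in \<open>[0, \<infinity>]\<close>, which has to be
  finite near \<open>v\<close>.\<close>

definition has_H_frechet_derivative ::
  "nat \<Rightarrow> (real^'n::finite) set \<Rightarrow> ((real^'n \<Rightarrow> real) \<Rightarrow> ennreal) \<Rightarrow> (real^'n \<Rightarrow> real) \<Rightarrow>
     ((real^'n \<Rightarrow> real) \<Rightarrow> real) \<Rightarrow> bool" where
  "has_H_frechet_derivative p S J v L \<longleftrightarrow>
     (\<forall>g\<in>Hspace p S. \<forall>h\<in>Hspace p S. L (\<lambda>x. g x + h x) = L g + L h) \<and>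
     (\<forall>a. \<forall>h\<in>Hspace p S. L (\<lambda>x. a * h x) = a * L h) \<and>
     (\<exists>B. \<forall>h\<in>Hspace p S. \<bar>L h\<bar> \<le> B * Hnorm p S h) \<and>
     (\<forall>e>0. \<exists>\<rho>>0. \<forall>h\<in>Hspace p S. Hnorm p S h < \<rho> \<longrightarrow>
        J (\<lambda>x. v x + h x) < \<infinity> \<and>
        \<bar>enn2real (J (\<lambda>x. v x + h x)) - enn2real (J v) - L h\<bar> \<le> e * Hnorm p S h)"

text \<open>Uniqueness is understood in \<open>H\<^sup>p(S)\<close>, i.e. up to equality almost everywhere on \<open>S\<close>.\<close>

definition unique_minimizer ::
  "(real^'n::finite) set \<Rightarrow> (real^'n \<Rightarrow> real) set \<Rightarrow> ((real^'n \<Rightarrow> real) \<Rightarrow> ennreal) \<Rightarrow>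
     (real^'n \<Rightarrow> real) \<Rightarrow> bool" where
  "unique_minimizer S A J v \<longleftrightarrow>
     v \<in> A \<and> (\<forall>u\<in>A. J v \<le> J u) \<and>
     (\<forall>w\<in>A. (\<forall>u\<in>A. J w \<le> J u) \<longrightarrow> (AE x in lebesgue_on S. w x = v x))"

definition cutoff ::
  "real \<Rightarrow> (real^'n::finite) set \<Rightarrow> real \<Rightarrow> real \<Rightarrow> (real^'n \<Rightarrow> real) \<Rightarrow> bool" where
  "cutoff R G \<delta> c ch \<longleftrightarrow>
     smooth ch \<and> c > 0 \<and>
     (\<forall>x\<in>G. ch x > c) \<and>
     (\<forall>x\<in>cube R - G. \<delta> < ch x \<and> ch x \<le> c) \<and>
     (\<forall>x. x \<notin> cube R \<longrightarrow> ch x = \<delta>)"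

definition HJ_F ::
  "(real^'n::finite \<Rightarrow> real) \<Rightarrow> real \<Rightarrow> real \<Rightarrow> (real^'n \<Rightarrow> real^'n \<Rightarrow> real) \<Rightarrow>
     real^'n \<Rightarrow> real \<Rightarrow> real^'n \<Rightarrow> real" where
  "HJ_F ch k \<mu> H x s q =
     ch x powr (2 * k) *
       (\<mu> * (s / ch x) + H x ((1 / (ch x)\<^sup>2) *\<^sub>R (ch x *\<^sub>R q - s *\<^sub>R grad ch x)))"

text \<open>The weight \<open>exp (2 \<lambda> r\<^sup>-\<^sup>\<beta>)\<close> with \<open>r = |x - x0|\<close>. It is infinite at \<open>x0\<close>, which may lie on the
  boundary of the cube.\<close>

definition weight :: "real \<Rightarrow> real \<Rightarrow> real^'n::finite \<Rightarrow> real^'n \<Rightarrow> ennreal" where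
  "weight lam \<beta> x0 x =
     (if x = x0 then \<infinity> else ennreal (exp (2 * lam * dist x x0 powr (- \<beta>))))"

definition interior_energy ::
  "real \<Rightarrow> real \<Rightarrow> real \<Rightarrow> real^'n::finite \<Rightarrow> (real^'n \<Rightarrow> real) \<Rightarrow> ennreal" where
  "interior_energy R lam \<beta> x0 v =
     (let u = C2_rep (cube R) v in
      \<integral>\<^sup>+ x. weight lam \<beta> x0 x * ennreal ((u x)\<^sup>2 + (norm (grad u x))\<^sup>2) \<partial>lebesgue_on (cube R))"

definition boundary_energy ::
  "real \<Rightarrow> real \<Rightarrow> real \<Rightarrow> real^'n::finite \<Rightarrow> (real^'n \<Rightarrow> real) \<Rightarrow> ennreal" where
  "boundary_energy R lam \<beta> x0 v =
     (let u = C2_rep (cube R) v in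
      surface_nn_integral R (\<lambda>x. weight lam \<beta> x0 x *
        ennreal ((bdry_value (cube R) u x)\<^sup>2 + (norm (bdry_value (cube R) (grad u) x))\<^sup>2)))"

definition J_fun ::
  "real \<Rightarrow> nat \<Rightarrow> (real^'n::finite \<Rightarrow> real \<Rightarrow> real^'n \<Rightarrow> real) \<Rightarrow> real \<Rightarrow> real \<Rightarrow> real \<Rightarrow> real^'n \<Rightarrow> real \<Rightarrow>
     (real^'n \<Rightarrow> real) \<Rightarrow> ennreal" where
  "J_fun R p F \<epsilon>0 lam \<beta> x0 \<eta> v =
     (let u = C2_rep (cube R) v in
      \<integral>\<^sup>+ x. weight lam \<beta> x0 x *
          ennreal ((- \<epsilon>0 * laplacian u x + F x (u x) (grad u x))\<^sup>2) \<partial>lebesgue_on (cube R))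
     + ennreal (lam ^ 4) * boundary_energy R lam \<beta> x0 v
     + ennreal (\<eta> * (Hnorm p (cube R) v)\<^sup>2)"

text \<open>The convexity inequality with constant \<open>C1\<close>. Truncating a negative left-hand side to \<open>0\<close>
  by \<open>ennreal\<close> loses nothing: for \<open>\<eta> > 0\<close> the right-hand side vanishes only if \<open>u = v\<close> in \<open>H\<^sup>p\<close>,
  and then both sides are \<open>0\<close>.\<close>

definition convexity_inequality ::
  "real \<Rightarrow> nat \<Rightarrow> (real^'n::finite \<Rightarrow> real \<Rightarrow> real^'n \<Rightarrow> real) \<Rightarrow> real \<Rightarrow> real \<Rightarrow> real \<Rightarrow> real^'n \<Rightarrow> real \<Rightarrow>
     ((real^'n \<Rightarrow> real) \<Rightarrow> (real^'n \<Rightarrow> real) \<Rightarrow> real) \<Rightarrow> real \<Rightarrow>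
     (real^'n \<Rightarrow> real) \<Rightarrow> (real^'n \<Rightarrow> real) \<Rightarrow> bool" where
  "convexity_inequality R p F \<epsilon>0 lam \<beta> x0 \<eta> DJ C1 u v \<longleftrightarrow>
     (let J = J_fun R p F \<epsilon>0 lam \<beta> x0 \<eta>; w = (\<lambda>x. u x - v x) in
      ennreal (enn2real (J u) - enn2real (J v) - DJ v w)
        \<ge> ennreal C1 * interior_energy R lam \<beta> x0 w
          + ennreal C1 * (ennreal (lam ^ 4) * boundary_energy R lam \<beta> x0 w)
          + ennreal (\<eta> * (Hnorm p (cube R) w)\<^sup>2))"

end

theory Submission
  imports Defs "HOL-Computational_Algebra.Polynomial"
begin

text \<open>Since \<open>H\<^sup>p\<close> balls are convex, the derivative of \<open>J\<close> at the minimizer is nonnegative in the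
  direction of the exact solution \<open>v\<close>; hence the convexity inequality between \<open>v\<close> and the minimizer
  bounds the weighted error by a multiple of \<open>J v\<close>. The interior term of \<open>J v\<close> vanishes by the
  differential equation and its boundary term is controlled by the Cauchy data, which are below
  \<open>C0 * \<delta>\<close>.

  As \<open>Hnorm\<close> picks weak derivatives by choice, even its homogeneity and convexity require that weak
  derivatives are unique. This follows by approximating indicators of boxes by smooth bumps and
  differentiating the resulting vanishing integrals over small boxes.\<close>

subsection \<open>Calculus of smooth functions\<close>

lemma Ck_closure_0_UNIV: "Ck_closure 0 UNIV f \<longleftrightarrow> continuous_on UNIV f"
proof -
  have "g = f" if "\<forall>x. g x = f x" for g using that by auto
  then show ?thesis by auto
qed

text \<open>On the whole space the only candidate for the continuous extension of \<open>f\<close>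
  is \<open>f\<close> itself, and differentiability makes it continuous.\<close>

lemma Ck_closure_Suc_UNIV:
  "Ck_closure (Suc k) UNIV f \<longleftrightarrow> (\<forall>x. f differentiable (at x)) \<and>
     (\<forall>b\<in>Basis. Ck_closure k UNIV (\<lambda>x. frechet_derivative f (at x) b))"
proof -
  have "continuous_on UNIV f" if "\<forall>x. f differentiable (at x)"
    using that differentiable_imp_continuous_within continuous_at_imp_continuous_on by blast
  then show ?thesis by auto
qed

lemmas Ck_closure_UNIV_simps = Ck_closure_0_UNIV Ck_closure_Suc_UNIV

lemma Ck_closure_SucD: "Ck_closure (Suc k) UNIV f \<Longrightarrow> Ck_closure k UNIV f"
proof (induction k arbitrary: f)
  case 0
  then show ?case by simp
next
  case (Suc k)
  from Suc.prems have "(\<forall>x. f differentiable (at x)) \<and>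
      (\<forall>b\<in>Basis. Ck_closure (Suc k) UNIV (\<lambda>x. frechet_derivative f (at x) b))"
    unfolding Ck_closure_Suc_UNIV[of "Suc k"] .
  with Suc.IH show ?case
    unfolding Ck_closure_Suc_UNIV[of k f] by blast
qed

text \<open>With \<open>T = UNIV\<close> this supplies the existence behind the choice in
  \<open>C2_rep\<close> for a function that is of class \<open>C2\<close> on the whole
  space.\<close>

lemma Ck_closure_mono:
  "Ck_closure k T f \<Longrightarrow> S \<subseteq> T \<Longrightarrow> Ck_closure k S f"
proof (induction k arbitrary: f)
  case 0
  then show ?case by simp (meson closure_mono continuous_on_subset subsetD)
next
  case (Suc k)
  from Suc.prems(1) obtain g where "continuous_on (closure T) g" "\<forall>x\<in>T. g x = f x" by auto
  then have "continuous_on (closure S) g \<and> (\<forall>x\<in>S. g x = f x)"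
    using Suc.prems(2) continuous_on_subset closure_mono by blast
  moreover have "\<forall>x\<in>S. f differentiable (at x)"
    using Suc.prems by auto
  moreover have "\<forall>b\<in>Basis. Ck_closure k S (\<lambda>x. frechet_derivative f (at x) b)"
    using Suc.IH Suc.prems by auto
  ultimately show ?case by auto
qed

lemma Ck_closure_const: "Ck_closure k UNIV (\<lambda>_. c)"
  by (induction k arbitrary: c)
    (simp_all add: Ck_closure_UNIV_simps del: Ck_closure.simps)

lemma Ck_closure_add:
  "Ck_closure k UNIV f \<Longrightarrow> Ck_closure k UNIV g \<Longrightarrow> Ck_closure k UNIV (\<lambda>x. f x + g x)"
proof (induction k arbitrary: f g)
  case 0
  then show ?case by (simp add: Ck_closure_0_UNIV continuous_on_add del: Ck_closure.simps)
next
  case (Suc k)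
  have D: "frechet_derivative (\<lambda>x. f x + g x) (at x) =
      (\<lambda>b. frechet_derivative f (at x) b + frechet_derivative g (at x) b)" for x
    using Suc.prems unfolding Ck_closure_Suc_UNIV
    by (intro frechet_derivative_at[symmetric] has_derivative_add)
      (auto simp: frechet_derivative_works)
  show ?case
    using Suc unfolding Ck_closure_Suc_UNIV D by auto
qed

lemma Ck_closure_mult:
  "Ck_closure k UNIV f \<Longrightarrow> Ck_closure k UNIV g \<Longrightarrow> Ck_closure k UNIV (\<lambda>x. f x * g x)"
proof (induction k arbitrary: f g)
  case 0
  then show ?case by (simp add: Ck_closure_0_UNIV continuous_on_mult del: Ck_closure.simps)
next
  case (Suc k)
  have D: "frechet_derivative (\<lambda>x. f x * g x) (at x) =
      (\<lambda>b. f x * frechet_derivative g (at x) b + frechet_derivative f (at x) b * g x)" for x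
    using Suc.prems unfolding Ck_closure_Suc_UNIV
    by (intro frechet_derivative_at[symmetric] has_derivative_mult)
      (auto simp: frechet_derivative_works)
  \<comment> \<open>The product rule multiplies derivatives, which are of class k, by the
    undifferentiated factors, so these have to be lowered from class \<open>Suc k\<close> to class k
    first.\<close>
  show ?case
    using Suc Ck_closure_SucD[OF Suc.prems(1)] Ck_closure_SucD[OF Suc.prems(2)]
    unfolding Ck_closure_Suc_UNIV D by (auto intro!: Ck_closure_add)
qed

lemma smooth_mult: "smooth f \<Longrightarrow> smooth g \<Longrightarrow> smooth (\<lambda>x. f x * g x)"
  by (simp add: smooth_def Ck_closure_mult)

lemma smooth_const: "smooth (\<lambda>_. c)"
  by (simp add: smooth_def Ck_closure_const)

lemma smooth_prod:
  "(\<And>i. i \<in> I \<Longrightarrow> smooth (f i)) \<Longrightarrow> smooth (\<lambda>x. \<Prod>i\<in>I. f i x)"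
  by (induction I rule: infinite_finite_induct)
    (simp_all add: smooth_const smooth_mult)

text \<open>The whole sequence of successive derivatives is carried along: a partial derivative of
  \<open>D j\<close> along an affine form is \<open>D (Suc j)\<close> along the same form times the
  constant \<open>b \<bullet> a\<close>, so the induction on k closes once j is arbitrary.\<close>

lemma Ck_closure_compose_affine:
  fixes D :: "nat \<Rightarrow> real \<Rightarrow> real" and a :: "'a::euclidean_space"
  assumes D: "\<And>j t. (D j has_real_derivative D (Suc j) t) (at t)"
  shows "Ck_closure k UNIV (\<lambda>x. D j (x \<bullet> a + c))"
proof -
  have der: "((\<lambda>x. D j (x \<bullet> a + c)) has_derivative (\<lambda>b. D (Suc j) (x \<bullet> a + c) * (b \<bullet> a))) (at x)"
    for j x
  proof -
    have "((\<lambda>x. x \<bullet> a + c) has_derivative (\<lambda>b. b \<bullet> a)) (at x)"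
      by (auto intro!: derivative_eq_intros)
    from has_derivative_compose[OF this D[unfolded has_field_derivative_def]]
    show ?thesis .
  qed
  have fd: "frechet_derivative (\<lambda>x. D j (x \<bullet> a + c)) (at x) =
      (\<lambda>b. D (Suc j) (x \<bullet> a + c) * (b \<bullet> a))" for j x
    using frechet_derivative_at[OF der] by simp
  show ?thesis
  proof (induction k arbitrary: j)
    case 0
    have "continuous_on UNIV (\<lambda>x. D j (x \<bullet> a + c))"
      by (intro continuous_at_imp_continuous_on ballI has_derivative_continuous[OF der])
    then show ?case by (simp only: Ck_closure_0_UNIV)
  next
    case (Suc k)
    have "(\<lambda>x. D j (x \<bullet> a + c)) differentiable (at x)" for x
      by (rule differentiableI[OF der])
    then show ?case
      unfolding Ck_closure_Suc_UNIV fd by (auto intro: Ck_closure_mult Suc Ck_closure_const)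
  qed
qed

subsection \<open>Test functions\<close>

text \<open>For \<open>p = 1\<close> this is the classical smooth function exp(-1/t) extended by 0.
  The polynomial factor in 1/t makes the family closed under differentiation.\<close>

definition flat :: "real poly \<Rightarrow> real \<Rightarrow> real" where
  "flat p t = (if t > 0 then poly p (inverse t) * exp (- inverse t) else 0)"

text \<open>From the right, substituting s = 1/t turns the claim into the decay of a polynomial
  times exp(-s) at infinity; from the left the function is zero.\<close>

lemma flat_tendsto_0: "(flat p \<longlongrightarrow> 0) (at 0)"
proof (rule filterlim_split_at)
  show "(flat p \<longlongrightarrow> 0) (at_left 0)"
    by (rule tendsto_eventually)
      (auto simp: flat_def eventually_at_left_field intro: exI[of _ "-1"])
  have "((\<lambda>s. \<Sum>i\<le>degree p. coeff p i * (s ^ i / exp s)) \<longlongrightarrow> (\<Sum>i\<le>degree p. coeff p i * 0)) at_top"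
    by (intro tendsto_sum tendsto_mult tendsto_const tendsto_power_div_exp_0)
  then have "((\<lambda>s. poly p s * exp (- s)) \<longlongrightarrow> 0) at_top"
    by (simp add: poly_altdef sum_divide_distrib exp_minus divide_inverse sum_distrib_right mult.assoc)
  from filterlim_compose[OF this filterlim_inverse_at_top_right]
  show "(flat p \<longlongrightarrow> 0) (at_right 0)"
    by (rule Lim_transform_eventually)
      (auto simp: flat_def eventually_at_right_field intro: exI[of _ 1])
qed

text \<open>For t > 0 the chain rule gives the factor (1/t)^2 times (p - p') at 1/t, and
  \<open>[:0, 0, 1:]\<close> is the polynomial that produces the square.\<close>

lemma flat_has_derivative:
  "(flat p has_real_derivative flat ([:0, 0, 1:] * (p - pderiv p)) t) (at t)"
proof -
  consider "t > 0" | "t < 0" | "t = 0" by linarith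
  then show ?thesis
  proof cases
    case 1
    have "((\<lambda>t. poly p (inverse t) * exp (- inverse t)) has_real_derivative
        flat ([:0, 0, 1:] * (p - pderiv p)) t) (at t)"
      using 1 by (auto intro!: derivative_eq_intros simp: flat_def field_simps power2_eq_square)
    then show ?thesis
      by (rule has_field_derivative_transform_within_open[of _ _ _ "{0<..}"])
        (use 1 in \<open>auto simp: flat_def\<close>)
  next
    case 2
    have "((\<lambda>_. 0) has_real_derivative flat ([:0, 0, 1:] * (p - pderiv p)) t) (at t)"
      using 2 by (simp add: flat_def)
    then show ?thesis
      by (rule has_field_derivative_transform_within_open[of _ _ _ "{..<0}"])
        (use 2 in \<open>auto simp: flat_def\<close>)
  next
    case 3
    \<comment> \<open>Dividing by h multiplies the polynomial by its variable, so the difference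
      quotient at 0 is a member of the same family. At \<open>h = 0\<close> both sides are
      0.\<close>
    have "(\<lambda>h. flat p h / h) = flat (pCons 0 p)"
      by (auto simp: flat_def field_simps)
    then have "((\<lambda>h. (flat p (0 + h) - flat p 0) / h) \<longlongrightarrow> 0) (at 0)"
      using flat_tendsto_0[of "pCons 0 p"] by (simp add: flat_def)
    then show ?thesis using 3 by (simp add: DERIV_def flat_def)
  qed
qed

lemma smooth_flat: "smooth (\<lambda>x. flat 1 (x \<bullet> a + c))"
proof -
  \<comment> \<open>Iterating the operator on polynomials from \<open>flat_has_derivative\<close>
    lists all derivatives of \<open>flat 1\<close>.\<close>
  define D where "D j = flat (((\<lambda>p. [:0, 0, 1:] * (p - pderiv p)) ^^ j) 1)" for j
  have "(D j has_real_derivative D (Suc j) t) (at t)" for j t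
    unfolding D_def by (simp only: funpow.simps o_apply flat_has_derivative)
  then have "Ck_closure k UNIV (\<lambda>x. D 0 (x \<bullet> a + c))" for k
    by (rule Ck_closure_compose_affine)
  then show ?thesis unfolding smooth_def by (simp add: D_def)
qed

lemma flat_bounds: "0 \<le> flat 1 t" "flat 1 t \<le> 1"
  by (auto simp: flat_def)

lemma flat_scaled_tendsto: "(\<lambda>n. flat 1 (real n * t)) \<longlonglongrightarrow> (if t > 0 then 1 else 0)"
proof (cases "t > 0")
  case True
  have "(\<lambda>n. exp (- inverse t * inverse (real n))) \<longlonglongrightarrow> exp (- inverse t * 0)"
    by (intro tendsto_intros lim_inverse_n)
  then have "(\<lambda>n. exp (- inverse t * inverse (real n))) \<longlonglongrightarrow> 1" by simp
  then have "(\<lambda>n. flat 1 (real n * t)) \<longlonglongrightarrow> 1"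
    by (rule Lim_transform_eventually)
      (use True in \<open>auto simp: flat_def eventually_sequentially intro!: exI[of _ 1]\<close>)
  then show ?thesis using True by simp
next
  case False
  then have "flat 1 (real n * t) = 0" for n
    by (auto simp: flat_def zero_less_mult_iff)
  then show ?thesis using False by simp
qed

text \<open>Each face of the box contributes one smooth step in the inward normal direction; n
  controls how steep the steps are.\<close>

definition bump :: "real^'n::finite \<Rightarrow> real^'n \<Rightarrow> nat \<Rightarrow> real^'n \<Rightarrow> real" where
  "bump a b n x = (\<Prod>i\<in>Basis. flat 1 (real n * (x \<bullet> i - a \<bullet> i)) * flat 1 (real n * (b \<bullet> i - x \<bullet> i)))"

lemma bump_bounds: "0 \<le> bump a b n x" "bump a b n x \<le> 1"
  unfolding bump_def
  by (auto intro!: prod_nonneg prod_le_1 mult_nonneg_nonneg mult_le_one flat_bounds)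

lemma bump_eq_0:
  assumes "x \<notin> cbox a b" shows "bump a b n x = 0"
proof -
  obtain i where i: "i \<in> Basis" "x \<bullet> i < a \<bullet> i \<or> b \<bullet> i < x \<bullet> i"
    using assms by (auto simp: mem_box not_le)
  have "flat 1 (real n * t) = 0" if "t < 0" for t
    using that by (auto simp: flat_def zero_less_mult_iff)
  then show ?thesis
    unfolding bump_def using i by (intro prod_zero bexI[of _ i]) auto
qed

text \<open>As \<open>flat 1 0 = 0\<close>, the limit vanishes on the faces, which is why the open
  box appears although the bumps are supported in the closed one.\<close>

lemma bump_tendsto: "(\<lambda>n. bump a b n x) \<longlonglongrightarrow> indicator (box a b) x"
proof -
  have "(\<lambda>n. bump a b n x) \<longlonglongrightarrow>
      (\<Prod>i\<in>Basis. (if x \<bullet> i - a \<bullet> i > 0 then 1 else 0) * (if b \<bullet> i - x \<bullet> i > 0 then 1 else 0))"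
    unfolding bump_def by (intro tendsto_prod tendsto_mult flat_scaled_tendsto)
  also have "(\<Prod>i\<in>Basis. (if x \<bullet> i - a \<bullet> i > 0 then 1 else 0) * (if b \<bullet> i - x \<bullet> i > 0 then 1 else 0)) =
      (indicator (box a b) x :: real)"
    by (force simp: indicator_def mem_box prod_zero_iff intro!: prod.neutral)
  finally show ?thesis .
qed

lemma smooth_bump: "smooth (bump a b n)"
proof -
  have "smooth (\<lambda>x. flat 1 (real n * (x \<bullet> i - a \<bullet> i)))" 
       "smooth (\<lambda>x. flat 1 (real n * (b \<bullet> i - x \<bullet> i)))" for i
    using smooth_flat[of "real n *\<^sub>R i" "- real n * (a \<bullet> i)"]
      smooth_flat[of "- real n *\<^sub>R i" "real n * (b \<bullet> i)"]
    by (simp_all add: algebra_simps)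
  then show ?thesis unfolding bump_def by (intro smooth_prod smooth_mult)
qed

lemma bump_test_fun: "cbox a b \<subseteq> S \<Longrightarrow> bump a b n \<in> test_fun S"
  using smooth_bump bump_eq_0 by (auto simp: test_fun_def intro!: exI[of _ "cbox a b"])

lemma smooth_continuous: "smooth f \<Longrightarrow> continuous_on UNIV f"
  using Ck_closure_0_UNIV smooth_def by blast

lemma smooth_pdiff: "smooth f \<Longrightarrow> smooth (pdiff i f)"
proof -
  assume "smooth f"
  then have "Ck_closure (Suc k) UNIV f" for k by (simp only: smooth_def)
  then have "Ck_closure k UNIV (\<lambda>x. frechet_derivative f (at x) (axis i 1))" for k
    unfolding Ck_closure_Suc_UNIV by (simp add: axis_in_Basis_iff)
  then show ?thesis by (simp add: smooth_def pdiff_def[abs_def])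
qed

lemma test_fun_pdiff:
  assumes "\<phi> \<in> test_fun S" shows "pdiff i \<phi> \<in> test_fun S"
proof -
  obtain K where K: "compact K" "K \<subseteq> S" "\<And>x. x \<notin> K \<Longrightarrow> \<phi> x = 0" and s: "smooth \<phi>"
    using assms by (auto simp: test_fun_def)
  have "pdiff i \<phi> x = 0" if "x \<notin> K" for x
  proof -
    \<comment> \<open>The compact set \<open>K\<close> is closed, so x has a neighbourhood on which
      the function vanishes identically.\<close>
    have "frechet_derivative (\<lambda>_. 0) (at x) = frechet_derivative \<phi> (at x)"
      by (rule frechet_derivative_transform_within_open[of _ _ "- K"])
        (use K that compact_imp_closed in auto)
    then show ?thesis by (metis pdiff_def frechet_derivative_const)
  qed
  then show ?thesis using K s smooth_pdiff by (auto simp: test_fun_def)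
qed

lemma test_fun_foldr_pdiff: "\<phi> \<in> test_fun S \<Longrightarrow> foldr pdiff is \<phi> \<in> test_fun S"
  by (induction "is") (auto intro: test_fun_pdiff)

subsection \<open>Weak derivatives\<close>

text \<open>The product is dominated by the sum of the squares, by the inequality between arithmetic
  and geometric means.\<close>

lemma L2_mult_integrable:
  assumes "f \<in> L2 S" "g \<in> L2 S"
  shows "integrable (lebesgue_on S) (\<lambda>x. f x * g x)"
proof (rule Bochner_Integration.integrable_bound)
  show "integrable (lebesgue_on S) (\<lambda>x. (f x)\<^sup>2 + (g x)\<^sup>2)"
    using assms by (auto simp: L2_def)
  show "(\<lambda>x. f x * g x) \<in> borel_measurable (lebesgue_on S)"
    using assms by (auto simp: L2_def)
  have "\<bar>a * b\<bar> \<le> a\<^sup>2 + b\<^sup>2" for a b :: real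
  proof -
    have "2 * \<bar>a * b\<bar> \<le> a\<^sup>2 + b\<^sup>2"
      using sum_squares_bound[of "\<bar>a\<bar>" "\<bar>b\<bar>"] by (simp add: abs_mult)
    then show ?thesis using abs_ge_zero[of "a * b"] by linarith
  qed
  then show "AE x in lebesgue_on S. norm (f x * g x) \<le> norm ((f x)\<^sup>2 + (g x)\<^sup>2)"
    by simp
qed

lemma L2_lincomb:
  assumes "f \<in> L2 S" "g \<in> L2 S"
  shows "(\<lambda>x. a * f x + b * g x) \<in> L2 S"
proof -
  have "integrable (lebesgue_on S) (\<lambda>x. a\<^sup>2 * (f x)\<^sup>2 + 2 * a * b * (f x * g x) + b\<^sup>2 * (g x)\<^sup>2)"
    using assms L2_mult_integrable[OF assms]
    by (intro Bochner_Integration.integrable_add integrable_mult_right) (auto simp: L2_def)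
  moreover have "(\<lambda>x. (a * f x + b * g x)\<^sup>2) =
      (\<lambda>x. a\<^sup>2 * (f x)\<^sup>2 + 2 * a * b * (f x * g x) + b\<^sup>2 * (g x)\<^sup>2)"
    by (auto simp: power2_eq_square algebra_simps)
  ultimately show ?thesis using assms by (auto simp: L2_def)
qed

section \<open>Functions in L2 that vanish against all test functions\<close>

lemma L2_integrable_on_cbox:
  assumes "w \<in> L2 S" "open S" "cbox a b \<subseteq> S"
  shows "w absolutely_integrable_on cbox a b"
proof -
  let ?C = "cbox a b"
  have S: "S \<in> sets lebesgue" using \<open>open S\<close> by simp
  have "set_integrable lebesgue S (\<lambda>x. (w x)\<^sup>2)"
    using assms S by (simp add: L2_def integrable_restrict_space set_integrable_def)
  then have "set_integrable lebesgue ?C (\<lambda>x. (w x)\<^sup>2)"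
    by (rule set_integrable_subset) (use assms in auto)
  moreover have "w \<in> borel_measurable (lebesgue_on ?C)"
    using assms measurable_restrict_mono by (auto simp: L2_def)
  ultimately have "w \<in> L2 ?C"
    by (simp add: L2_def integrable_restrict_space set_integrable_def)
  \<comment> \<open>A box has finite measure, so the constant 1 is square integrable there and w
    itself is a product of two such functions.\<close>
  moreover have "(\<lambda>_. 1) \<in> L2 ?C"
    using lmeasurable_cbox[of a b] by (auto simp: L2_def finite_measure_lebesgue_on finite_measure.integrable_const)
  ultimately have "integrable (lebesgue_on ?C) (\<lambda>x. w x * 1)"
    by (rule L2_mult_integrable)
  then show ?thesis
    by (simp add: integrable_restrict_space set_integrable_def)
qed

lemma test_fun_L2:
  assumes "\<phi> \<in> test_fun S" "open S"
  shows "\<phi> \<in> L2 S"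
proof -
  obtain K where K: "compact K" "K \<subseteq> S" "\<And>x. x \<notin> K \<Longrightarrow> \<phi> x = 0" and s: "smooth \<phi>"
    using assms by (auto simp: test_fun_def)
  have c: "continuous_on T \<phi>" for T
    using smooth_continuous[OF s] continuous_on_subset by blast
  have "integrable lborel (\<lambda>x. indicator K x *\<^sub>R (\<phi> x)\<^sup>2)"
    by (rule borel_integrable_compact[OF K(1)]) (intro continuous_on_power c)
  then have "integrable lebesgue (\<lambda>x. indicator K x *\<^sub>R (\<phi> x)\<^sup>2)"
    by (subst integrable_completion) auto
  moreover have "(\<lambda>x. indicator K x *\<^sub>R (\<phi> x)\<^sup>2) = (\<lambda>x. indicator S x *\<^sub>R (\<phi> x)\<^sup>2)"
    using K by (force simp: indicator_def)
  ultimately have "integrable (lebesgue_on S) (\<lambda>x. (\<phi> x)\<^sup>2)"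
    using assms by (simp add: integrable_restrict_space)
  moreover have "\<phi> \<in> borel_measurable (lebesgue_on S)"
    using assms c by (intro continuous_imp_measurable_on_sets_lebesgue) auto
  ultimately show ?thesis by (simp add: L2_def)
qed

text \<open>The bumps are test functions tending to the indicator of the open box. The products with
  w are dominated by the integrable function |w|, so the limit passes under the integral; closed and
  open box have the same integral.\<close>

lemma integral_cbox_eq_0:
  assumes "w \<in> L2 S" "open S" "cbox a b \<subseteq> S"
    and 0: "\<And>\<phi>. \<phi> \<in> test_fun S \<Longrightarrow> (LINT x|lebesgue_on S. w x * \<phi> x) = 0"
  shows "integral (cbox a b) w = 0"
proof -
  have abs: "w absolutely_integrable_on cbox a b"
    by (rule L2_integrable_on_cbox) fact+
  have hi: "((\<lambda>x. w x * bump a b n x) has_integral 0) (cbox a b)" for n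
  proof -
    have t: "bump a b n \<in> test_fun S" by (rule bump_test_fun) fact
    then have "integrable (lebesgue_on S) (\<lambda>x. w x * bump a b n x)"
      using L2_mult_integrable test_fun_L2 assms by blast
    from has_integral_integral_lebesgue_on[OF this] 0[OF t] \<open>open S\<close>
    have "((\<lambda>x. w x * bump a b n x) has_integral 0) S" by simp
    moreover have "(\<lambda>x. if x \<in> cbox a b then w x * bump a b n x else 0) = (\<lambda>x. w x * bump a b n x)"
      by (auto simp: bump_eq_0)
    ultimately show ?thesis
      using has_integral_restrict[OF \<open>cbox a b \<subseteq> S\<close>, of "\<lambda>x. w x * bump a b n x" 0] by simp
  qed
  have "(\<lambda>n. integral (cbox a b) (\<lambda>x. w x * bump a b n x)) \<longlonglongrightarrow>
      integral (cbox a b) (\<lambda>x. w x * indicator (box a b) x)"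
  proof (rule dominated_convergence)
    show "(\<lambda>x. w x * bump a b n x) integrable_on cbox a b" for n
      using hi by blast
    show "(\<lambda>x. norm (w x)) integrable_on cbox a b"
      using abs by (simp add: absolutely_integrable_on_def)
    show "norm (w x * bump a b n x) \<le> norm (w x)" for n x
      using bump_bounds[of a b n x] by (simp add: abs_mult mult_left_le)
    show "(\<lambda>n. w x * bump a b n x) \<longlonglongrightarrow> w x * indicator (box a b) x" for x
      by (intro tendsto_mult tendsto_const bump_tendsto)
  qed
  then have "integral (cbox a b) (\<lambda>x. w x * indicator (box a b) x) = 0"
    by (simp add: integral_unique[OF hi] LIMSEQ_const_iff)
  moreover have "(\<lambda>x. w x * indicator (box a b) x) = (\<lambda>x. if x \<in> box a b then w x else 0)"
    by (auto simp: indicator_def)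
  ultimately have "integral (box a b \<inter> cbox a b) w = 0"
    using integral_restrict_Int[of "cbox a b" "box a b" w] by simp
  moreover have "box a b \<inter> cbox a b = box a b" using box_subset_cbox by blast
  ultimately show ?thesis by (simp add: integral_open_interval)
qed

text \<open>All averages of w over small cubes vanish, so w vanishes almost everywhere by Lebesgue
  differentiation. This is done inside one closed box at a time, and countably many such boxes cover
  the open set.\<close>

lemma fundamental_lemma_variations:
  assumes "w \<in> L2 S" "open S"
    and 0: "\<And>\<phi>. \<phi> \<in> test_fun S \<Longrightarrow> (LINT x|lebesgue_on S. w x * \<phi> x) = 0"
  shows "AE x in lebesgue_on S. w x = 0"
proof -
  have neg: "negligible {x \<in> cbox a b. w x \<noteq> 0}" if ab: "cbox a b \<subseteq> S" for a b
  proof -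
    \<comment> \<open>The differentiation theorem requires integrability on every box, also on those
      leaving \<open>S\<close>; the cut-off ensures this and keeps all integrals zero, because two
      boxes meet in a box.\<close>
    define f where "f x = (if x \<in> cbox a b then w x else 0)" for x
    have f: "f integrable_on cbox c d \<and> integral (cbox c d) f = 0" for c d
    proof -
      obtain c' d' where e: "cbox a b \<inter> cbox c d = cbox c' d'"
        using Int_interval by blast
      then have "cbox c' d' \<subseteq> S" using ab by blast
      with assms have "w integrable_on cbox c' d'" "integral (cbox c' d') w = 0"
        using L2_integrable_on_cbox integral_cbox_eq_0
        by (blast intro: set_lebesgue_integral_eq_integral)+
      then show ?thesis
        unfolding f_def using e by (simp add: integral_restrict_Int integrable_restrict_Int)
    qed
    obtain N where N: "negligible N" "\<And>x e. \<lbrakk>x \<notin> N; 0 < e\<rbrakk> \<Longrightarrow>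
        \<exists>d>0. \<forall>h. 0 < h \<and> h < d \<longrightarrow>
          norm (integral (cbox x (x + h *\<^sub>R One)) f /\<^sub>R h ^ DIM(real^'a) - f x) < e"
      using integrable_ccontinuous_explicit[of f] f by metis
    have zero: "f x = 0" if x: "x \<notin> N" for x
    proof (rule ccontr)
      assume "f x \<noteq> 0"
      \<comment> \<open>With all averages equal to 0, closeness within \<open>norm (f x)\<close>
        would read \<open>norm (f x) < norm (f x)\<close>, so no h could lie strictly between 0 and
        d.\<close>
      then have "\<exists>d>0::real. \<forall>h>0. \<not> h < d"
        using N(2)[OF x, of "norm (f x)"] f by simp
      then show False using dense by blast
    qed
    have "x \<in> N" if "x \<in> cbox a b" "w x \<noteq> 0" for x
      using zero[of x] that by (cases "x \<in> N") (auto simp: f_def)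
    then have "{x \<in> cbox a b. w x \<noteq> 0} \<subseteq> N" by blast
    then show ?thesis using N(1) negligible_subset by blast
  qed
  show ?thesis
  proof (rule open_countable_Union_open_cbox[OF \<open>open S\<close>])
    fix \<D> assume D: "countable \<D>" "\<D> \<subseteq> Pow S" "\<And>X. X \<in> \<D> \<Longrightarrow> \<exists>a b. X = cbox a b" "\<Union>\<D> = S"
    have "negligible (\<Union>X\<in>\<D>. {x \<in> X. w x \<noteq> 0})"
    proof (rule negligible_countable_Union)
      fix T assume "T \<in> (\<lambda>X. {x \<in> X. w x \<noteq> 0}) ` \<D>"
      then obtain X where X: "X \<in> \<D>" "T = {x \<in> X. w x \<noteq> 0}" by auto
      with D(2,3) obtain a b where "X = cbox a b" "cbox a b \<subseteq> S" by blast
      with neg X(2) show "negligible T" by simp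
    qed (simp add: D(1))
    moreover have "(\<Union>X\<in>\<D>. {x \<in> X. w x \<noteq> 0}) = {x \<in> S. w x \<noteq> 0}"
      using D(4) by auto
    ultimately have "{x \<in> S. w x \<noteq> 0} \<in> null_sets lebesgue"
      by (simp add: negligible_iff_null_sets)
    then have "AE x in lebesgue. x \<in> S \<longrightarrow> w x = 0"
      by (rule AE_I') auto
    then show ?thesis
      using \<open>open S\<close> by (simp add: AE_restrict_space_iff)
  qed
qed

lemma weak_deriv_lincomb:
  assumes "open S" "v \<in> L2 S" "v' \<in> L2 S" "w \<in> L2 S" "w' \<in> L2 S"
    and "weak_deriv S \<alpha> v w" "weak_deriv S \<alpha> v' w'"
  shows "weak_deriv S \<alpha> (\<lambda>x. a * v x + b * v' x) (\<lambda>x. a * w x + b * w' x)"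
proof -
  \<comment> \<open>The Bochner integral is additive only for integrable summands; they are
    integrable because test functions belong to L2.\<close>
  have lin: "(LINT x|lebesgue_on S. (a * f x + b * g x) * \<phi> x) =
      a * (LINT x|lebesgue_on S. f x * \<phi> x) + b * (LINT x|lebesgue_on S. g x * \<phi> x)"
    if "\<phi> \<in> test_fun S" "f \<in> L2 S" "g \<in> L2 S" for f g \<phi>
    using L2_mult_integrable[OF that(2) test_fun_L2[OF that(1) \<open>open S\<close>]]
      L2_mult_integrable[OF that(3) test_fun_L2[OF that(1) \<open>open S\<close>]]
    by (simp add: distrib_right mult.assoc)
  show ?thesis
    unfolding weak_deriv_def
  proof (intro ballI allI impI)
    fix \<phi> "is" assume p: "\<phi> \<in> test_fun S" and i: "mset is = \<alpha>"
    have "(LINT x|lebesgue_on S. v x * foldr pdiff is \<phi> x) =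
          (- 1) ^ size \<alpha> * (LINT x|lebesgue_on S. w x * \<phi> x)"
      "(LINT x|lebesgue_on S. v' x * foldr pdiff is \<phi> x) =
          (- 1) ^ size \<alpha> * (LINT x|lebesgue_on S. w' x * \<phi> x)"
      using assms(6,7) p i unfolding weak_deriv_def by blast+
    then show "(LINT x|lebesgue_on S. (a * v x + b * v' x) * foldr pdiff is \<phi> x) =
        (- 1) ^ size \<alpha> * (LINT x|lebesgue_on S. (a * w x + b * w' x) * \<phi> x)"
      unfolding lin[OF test_fun_foldr_pdiff[OF p] assms(2,3)] lin[OF p assms(4,5)]
      by (simp add: algebra_simps)
  qed
qed

text \<open>The sign cancels after testing along one enumeration of the multi-index, so the
  difference of the two candidates integrates to zero against every test function.\<close>

lemma weak_deriv_unique: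
  assumes "open S" "w \<in> L2 S" "w' \<in> L2 S" "weak_deriv S \<alpha> v w" "weak_deriv S \<alpha> v w'"
  shows "AE x in lebesgue_on S. w x = w' x"
proof -
  have d: "(\<lambda>x. 1 * w x + (-1) * w' x) \<in> L2 S" by (rule L2_lincomb) fact+
  have "AE x in lebesgue_on S. 1 * w x + (-1) * w' x = 0"
  proof (rule fundamental_lemma_variations[OF d \<open>open S\<close>])
    fix \<phi> assume p: "\<phi> \<in> test_fun S"
    obtain "is" where "mset is = \<alpha>" using ex_mset by blast
    then have "(- 1) ^ size \<alpha> * (LINT x|lebesgue_on S. w x * \<phi> x) =
        (- 1) ^ size \<alpha> * (LINT x|lebesgue_on S. w' x * \<phi> x)"
      using assms(4,5) p unfolding weak_deriv_def by fastforce
    then have "(LINT x|lebesgue_on S. w x * \<phi> x) = (LINT x|lebesgue_on S. w' x * \<phi> x)"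
      by simp
    then show "(LINT x|lebesgue_on S. (1 * w x + (-1) * w' x) * \<phi> x) = 0"
      using L2_mult_integrable[OF assms(2) test_fun_L2[OF p \<open>open S\<close>]]
        L2_mult_integrable[OF assms(3) test_fun_L2[OF p \<open>open S\<close>]]
      by (simp add: left_diff_distrib)
  qed
  then show ?thesis by simp
qed

subsection \<open>The Sobolev norm\<close>

lemma wderiv:
  assumes "v \<in> Hspace p S" "size \<alpha> \<le> p"
  shows "wderiv S \<alpha> v \<in> L2 S" "weak_deriv S \<alpha> v (wderiv S \<alpha> v)"
proof -
  have "\<exists>w. w \<in> L2 S \<and> weak_deriv S \<alpha> v w"
    using assms by (auto simp: Hspace_def)
  from someI_ex[OF this] show "wderiv S \<alpha> v \<in> L2 S" "weak_deriv S \<alpha> v (wderiv S \<alpha> v)"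
    by (simp_all add: wderiv_def)
qed

lemma Hspace_lincomb:
  assumes "open S" "f \<in> Hspace p S" "g \<in> Hspace p S"
  shows "(\<lambda>x. a * f x + b * g x) \<in> Hspace p S"
proof -
  have L: "f \<in> L2 S" "g \<in> L2 S" using assms by (auto simp: Hspace_def)
  have "\<exists>w\<in>L2 S. weak_deriv S \<alpha> (\<lambda>x. a * f x + b * g x) w" if "size \<alpha> \<le> p" for \<alpha>
    using weak_deriv_lincomb[OF assms(1) L wderiv(1)[OF assms(2) that] wderiv(1)[OF assms(3) that]
        wderiv(2)[OF assms(2) that] wderiv(2)[OF assms(3) that]]
      L2_lincomb[OF wderiv(1)[OF assms(2) that] wderiv(1)[OF assms(3) that]] by blast
  then show ?thesis using L2_lincomb[OF L] by (simp add: Hspace_def)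
qed

lemma Hspace_diff:
  "open S \<Longrightarrow> f \<in> Hspace p S \<Longrightarrow> g \<in> Hspace p S \<Longrightarrow> (\<lambda>x. f x - g x) \<in> Hspace p S"
  using Hspace_lincomb[of S f p g 1 "-1"] by simp

text \<open>\<open>wderiv\<close> is an arbitrary choice and hence not linear by itself, but both
  sides are weak derivatives of the same function.\<close>

lemma wderiv_lincomb:
  assumes "open S" "f \<in> Hspace p S" "g \<in> Hspace p S" "size \<alpha> \<le> p"
  shows "AE x in lebesgue_on S.
    wderiv S \<alpha> (\<lambda>x. a * f x + b * g x) x = a * wderiv S \<alpha> f x + b * wderiv S \<alpha> g x"
proof (rule weak_deriv_unique[OF \<open>open S\<close>])
  note f = wderiv[OF assms(2,4)] and g = wderiv[OF assms(3,4)]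
    and h = wderiv[OF Hspace_lincomb[OF assms(1-3), of a b] assms(4)]
  show "wderiv S \<alpha> (\<lambda>x. a * f x + b * g x) \<in> L2 S"
    "weak_deriv S \<alpha> (\<lambda>x. a * f x + b * g x) (wderiv S \<alpha> (\<lambda>x. a * f x + b * g x))"
    by (fact h)+
  show "(\<lambda>x. a * wderiv S \<alpha> f x + b * wderiv S \<alpha> g x) \<in> L2 S"
    by (rule L2_lincomb) (fact f(1), fact g(1))
  show "weak_deriv S \<alpha> (\<lambda>x. a * f x + b * g x) (\<lambda>x. a * wderiv S \<alpha> f x + b * wderiv S \<alpha> g x)"
    using assms f g by (intro weak_deriv_lincomb) (auto simp: Hspace_def)
qed

lemma Hnorm_nonneg: "0 \<le> Hnorm p S v"
  unfolding Hnorm_def by (intro real_sqrt_ge_zero sum_nonneg Bochner_Integration.integral_nonneg) auto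

lemma Hnorm_sq: "(Hnorm p S v)\<^sup>2 = (\<Sum>\<alpha>\<in>{\<alpha>. size \<alpha> \<le> p}. LINT x|lebesgue_on S. (wderiv S \<alpha> v x)\<^sup>2)"
  unfolding Hnorm_def
  by (intro real_sqrt_pow2 sum_nonneg Bochner_Integration.integral_nonneg) auto

text \<open>Convexity of the square is inherited directly from the pointwise inequality for each
  derivative. It suffices for the convexity of balls and takes the place of the triangle
  inequality.\<close>

lemma Hnorm_sq_convex:
  assumes "open S" "f \<in> Hspace p S" "g \<in> Hspace p S" "a \<ge> 0" "b \<ge> 0" "a + b = 1"
  shows "(Hnorm p S (\<lambda>x. a * f x + b * g x))\<^sup>2 \<le> a * (Hnorm p S f)\<^sup>2 + b * (Hnorm p S g)\<^sup>2"
proof -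
  have pt: "(a * s + b * t)\<^sup>2 \<le> a * s\<^sup>2 + b * t\<^sup>2" for s t :: real
  proof -
    have b: "b = 1 - a" using assms by simp
    \<comment> \<open>The defect in the convexity of the square is an explicit nonnegative
      term.\<close>
    have "a * s\<^sup>2 + b * t\<^sup>2 - (a * s + b * t)\<^sup>2 = a * b * (s - t)\<^sup>2"
      unfolding b by (simp add: power2_eq_square algebra_simps)
    then show ?thesis using assms by (smt (verit) mult_nonneg_nonneg zero_le_power2)
  qed
  have "(LINT x|lebesgue_on S. (wderiv S \<alpha> (\<lambda>x. a * f x + b * g x) x)\<^sup>2) \<le>
      a * (LINT x|lebesgue_on S. (wderiv S \<alpha> f x)\<^sup>2) + b * (LINT x|lebesgue_on S. (wderiv S \<alpha> g x)\<^sup>2)"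
    if "size \<alpha> \<le> p" for \<alpha>
  proof -
    note f = wderiv(1)[OF assms(2) that] and g = wderiv(1)[OF assms(3) that]
      and h = wderiv(1)[OF Hspace_lincomb[OF assms(1-3), of a b] that]
    have "(LINT x|lebesgue_on S. (wderiv S \<alpha> (\<lambda>x. a * f x + b * g x) x)\<^sup>2) \<le>
        (LINT x|lebesgue_on S. a * (wderiv S \<alpha> f x)\<^sup>2 + b * (wderiv S \<alpha> g x)\<^sup>2)"
    proof (rule integral_mono_AE)
      show "AE x in lebesgue_on S. (wderiv S \<alpha> (\<lambda>x. a * f x + b * g x) x)\<^sup>2
          \<le> a * (wderiv S \<alpha> f x)\<^sup>2 + b * (wderiv S \<alpha> g x)\<^sup>2"
        using wderiv_lincomb[OF assms(1-3) that, of a b] by eventually_elim (simp add: pt)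
    qed (use f g h in \<open>auto simp: L2_def\<close>)
    also have "\<dots> = a * (LINT x|lebesgue_on S. (wderiv S \<alpha> f x)\<^sup>2) + b * (LINT x|lebesgue_on S. (wderiv S \<alpha> g x)\<^sup>2)"
      using f g by (simp add: L2_def)
    finally show ?thesis .
  qed
  then show ?thesis
    unfolding Hnorm_sq sum_distrib_left sum.distrib[symmetric] by (intro sum_mono) auto
qed

lemma Hnorm_scale:
  assumes "open S" "f \<in> Hspace p S"
  shows "Hnorm p S (\<lambda>x. a * f x) = \<bar>a\<bar> * Hnorm p S f"
proof -
  have "(LINT x|lebesgue_on S. (wderiv S \<alpha> (\<lambda>x. a * f x) x)\<^sup>2) =
      a\<^sup>2 * (LINT x|lebesgue_on S. (wderiv S \<alpha> f x)\<^sup>2)" if "size \<alpha> \<le> p" for \<alpha>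
  proof -
    note f = wderiv(1)[OF assms(2) that]
      and h = wderiv(1)[OF Hspace_lincomb[OF assms(1,2,2), of a 0] that]
    have "(LINT x|lebesgue_on S. (wderiv S \<alpha> (\<lambda>x. a * f x) x)\<^sup>2) =
        (LINT x|lebesgue_on S. a\<^sup>2 * (wderiv S \<alpha> f x)\<^sup>2)"
    proof (rule integral_cong_AE)
      show "AE x in lebesgue_on S. (wderiv S \<alpha> (\<lambda>x. a * f x) x)\<^sup>2 = a\<^sup>2 * (wderiv S \<alpha> f x)\<^sup>2"
        using wderiv_lincomb[OF assms(1,2,2) that, of a 0]
        by (auto simp: power_mult_distrib elim!: eventually_mono)
    qed (use f h in \<open>auto simp: L2_def\<close>)
    then show ?thesis by simp
  qed
  then have "(\<Sum>\<alpha>\<in>{\<alpha>. size \<alpha> \<le> p}. LINT x|lebesgue_on S. (wderiv S \<alpha> (\<lambda>x. a * f x) x)\<^sup>2) =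
      a\<^sup>2 * (\<Sum>\<alpha>\<in>{\<alpha>. size \<alpha> \<le> p}. LINT x|lebesgue_on S. (wderiv S \<alpha> f x)\<^sup>2)"
    by (simp add: sum_distrib_left)
  then show ?thesis unfolding Hnorm_def by (simp add: real_sqrt_mult)
qed

section \<open>Convexity of closed balls and the first-order condition at a minimizer\<close>

lemma Hclosure_Hball_convex:
  assumes S: "open S" and f: "f \<in> Hclosure p S (Hball p S M)" and g: "g \<in> Hclosure p S (Hball p S M)"
    and ab: "a \<ge> 0" "b \<ge> 0" "a + b = 1"
  shows "(\<lambda>x. a * f x + b * g x) \<in> Hclosure p S (Hball p S M)"
proof -
  have H: "f \<in> Hspace p S" "g \<in> Hspace p S" using f g by (auto simp: Hclosure_def)
  \<comment> \<open>This serves twice: with \<open>e = M\<close> it keeps the combined approximants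
    in the ball, and with a small e it bounds the combined approximation error.\<close>
  have sq: "Hnorm p S (\<lambda>x. a * u x + b * v x) < e"
    if "u \<in> Hspace p S" "v \<in> Hspace p S" "Hnorm p S u < e" "Hnorm p S v < e" for u v e
  proof (rule power2_less_imp_less)
    have e: "e > 0" using that Hnorm_nonneg[of p S u] by linarith
    then show "0 \<le> e" by simp
    have "(Hnorm p S u)\<^sup>2 < e\<^sup>2" "(Hnorm p S v)\<^sup>2 < e\<^sup>2"
      using that by (simp_all add: power_strict_mono Hnorm_nonneg)
    then have "a * (Hnorm p S u)\<^sup>2 + b * (Hnorm p S v)\<^sup>2 < e\<^sup>2"
      using ab by (intro convex_bound_lt)
    with Hnorm_sq_convex[OF S that(1,2) ab]
    show "(Hnorm p S (\<lambda>x. a * u x + b * v x))\<^sup>2 < e\<^sup>2" by linarith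
  qed
  have "\<exists>w\<in>Hball p S M. Hnorm p S (\<lambda>x. (a * f x + b * g x) - w x) < e" if "e > 0" for e
  proof -
    from f g that obtain u v where u: "u \<in> Hball p S M" "Hnorm p S (\<lambda>x. f x - u x) < e"
      and v: "v \<in> Hball p S M" "Hnorm p S (\<lambda>x. g x - v x) < e"
      by (auto simp: Hclosure_def) blast
    have uv: "u \<in> Hspace p S" "v \<in> Hspace p S" "Hnorm p S u < M" "Hnorm p S v < M"
      using u v by (auto simp: Hball_def)
    have "(\<lambda>x. a * u x + b * v x) \<in> Hball p S M"
      using sq[OF uv] Hspace_lincomb[OF S uv(1,2)] by (simp add: Hball_def)
    moreover have "Hnorm p S (\<lambda>x. a * (f x - u x) + b * (g x - v x)) < e"
      using u v uv H S by (intro sq Hspace_diff)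
    ultimately show ?thesis
      by (intro bexI[of _ "\<lambda>x. a * u x + b * v x"]) (simp_all add: algebra_simps)
  qed
  then show ?thesis using Hspace_lincomb[OF S H] by (simp add: Hclosure_def)
qed

text \<open>Moving from v a fraction t towards u stays in the convex set and cannot decrease
  \<open>J\<close>. The first-order expansion then makes t times the directional derivative
  nonnegative up to an error of order e' t, and dividing by t leaves an arbitrarily small
  error.\<close>

lemma frechet_derivative_nonneg_at_minimizer:
  assumes S: "open S" and A: "A = Hclosure p S (Hball p S M)" and v: "v \<in> A" and u: "u \<in> A"
    and min: "\<And>w. w \<in> A \<Longrightarrow> J v \<le> J w"
    and L: "has_H_frechet_derivative p S J v L"
  shows "0 \<le> L (\<lambda>x. u x - v x)"
proof (rule field_le_epsilon)
  let ?d = "\<lambda>x. u x - v x"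
  have H: "?d \<in> Hspace p S"
    using u v A by (auto intro!: Hspace_diff[OF S] simp: Hclosure_def)
  let ?N = "Hnorm p S ?d"
  fix e :: real assume "e > 0"
  \<comment> \<open>The added 1 covers the case that the direction has norm 0.\<close>
  define e' where "e' = e / (?N + 1)"
  have e': "e' > 0" "e' * ?N \<le> e"
    using \<open>e > 0\<close> Hnorm_nonneg[of p S ?d] by (auto simp: e'_def field_simps)
  then obtain \<rho> where \<rho>: "\<rho> > 0" "\<And>h. h \<in> Hspace p S \<Longrightarrow> Hnorm p S h < \<rho> \<Longrightarrow>
        J (\<lambda>x. v x + h x) < \<infinity> \<and>
        \<bar>enn2real (J (\<lambda>x. v x + h x)) - enn2real (J v) - L h\<bar> \<le> e' * Hnorm p S h"
    using L unfolding has_H_frechet_derivative_def by meson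
  \<comment> \<open>The bound 1 keeps the point on the segment from v to u; the other bound makes
    the increment shorter than the radius in the definition of the derivative.\<close>
  define t where "t = min 1 (\<rho> / (2 * (?N + 1)))"
  have t: "0 < t" "t \<le> 1" "t * ?N < \<rho>"
  proof -
    have N: "?N \<ge> 0" by (rule Hnorm_nonneg)
    then show "0 < t" using \<rho> by (simp add: t_def)
    show "t \<le> 1" by (simp add: t_def)
    have "t * ?N \<le> \<rho> / (2 * (?N + 1)) * ?N"
      using N by (intro mult_right_mono) (simp_all add: t_def)
    also have "\<dots> < \<rho>" using N \<rho> by (simp add: field_simps add_pos_nonneg)
    finally show "t * ?N < \<rho>" .
  qed
  let ?h = "\<lambda>x. t * ?d x"
  have h: "?h \<in> Hspace p S" using Hspace_lincomb[OF S H H, of t 0] by simp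
  have nh: "Hnorm p S ?h = t * ?N" using Hnorm_scale[OF S H, of t] t by simp
  have "(\<lambda>x. (1 - t) * v x + t * u x) \<in> A"
    using t u v unfolding A by (intro Hclosure_Hball_convex[OF S]) auto
  moreover have "(\<lambda>x. (1 - t) * v x + t * u x) = (\<lambda>x. v x + ?h x)"
    by (auto simp: algebra_simps)
  ultimately have le: "J v \<le> J (\<lambda>x. v x + ?h x)" using min by metis
  \<comment> \<open>Finiteness matters because \<open>enn2real\<close> sends infinity to 0 and is
    monotone only below finite values.\<close>
  have fin: "J (\<lambda>x. v x + ?h x) < \<infinity>"
    and ab: "\<bar>enn2real (J (\<lambda>x. v x + ?h x)) - enn2real (J v) - L ?h\<bar> \<le> e' * (t * ?N)"
    using \<rho>(2)[OF h] nh t by auto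
  have "enn2real (J v) \<le> enn2real (J (\<lambda>x. v x + ?h x))"
    using le fin by (intro enn2real_mono) auto
  with ab have "0 \<le> L ?h + e' * (t * ?N)" by linarith
  moreover have "L ?h = t * L ?d"
    using L H unfolding has_H_frechet_derivative_def by (elim conjE) simp
  ultimately have "0 \<le> t * (L ?d + e' * ?N)" by (simp add: algebra_simps)
  with t have "0 \<le> L ?d + e' * ?N" by (simp add: zero_le_mult_iff)
  with e' show "0 \<le> L ?d + e" by linarith
qed

subsection \<open>The functional at the exact solution\<close>

lemma C2_pdiff:
  assumes "Ck_closure 2 UNIV v"
  shows "v differentiable (at x)" "pdiff i v differentiable (at x)"
    "continuous_on UNIV v" "continuous_on UNIV (pdiff i v)"
proof -
  have 2: "Ck_closure (Suc (Suc 0)) UNIV v" using assms by (simp only: numeral_2_eq_2)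
  then have b: "Ck_closure (Suc 0) UNIV (pdiff i v)"
    unfolding Ck_closure_Suc_UNIV[of "Suc 0"] pdiff_def[abs_def] by (simp add: axis_in_Basis_iff)
  show "v differentiable (at x)" "pdiff i v differentiable (at x)"
    using 2 b unfolding Ck_closure_Suc_UNIV by simp_all
  show "continuous_on UNIV v" "continuous_on UNIV (pdiff i v)"
    using 2 b Ck_closure_SucD Ck_closure_0_UNIV by blast+
qed

lemma grad_continuous: "Ck_closure 2 UNIV v \<Longrightarrow> continuous_on UNIV (grad v)"
  unfolding grad_def[abs_def] by (intro continuous_on_vec_lambda C2_pdiff(4))

text \<open>The chosen representative and v are both continuous on \<open>S\<close> and agree almost
  everywhere, so the set where they differ is open and null, hence empty.\<close>

lemma C2_rep_eq:
  assumes "Ck_closure 2 UNIV v" "open S" "x \<in> S"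
  shows "C2_rep S v x = v x"
proof -
  let ?u = "C2_rep S v"
  have "\<exists>u. Ck_closure 2 S u \<and> (AE x in lebesgue_on S. u x = v x)"
    using Ck_closure_mono[OF assms(1) subset_UNIV] by auto
  from someI_ex[OF this] have u: "Ck_closure 2 S ?u" "AE x in lebesgue_on S. ?u x = v x"
    by (simp_all add: C2_rep_def)
  have "?u differentiable (at x)" if "x \<in> S" for x
    using u(1) that by (simp add: numeral_2_eq_2)
  then have "continuous_on S ?u"
    by (intro continuous_at_imp_continuous_on ballI differentiable_imp_continuous_within)
  then have "continuous_on S (\<lambda>x. ?u x - v x)"
    using C2_pdiff(3)[OF assms(1)] by (intro continuous_on_diff) (auto intro: continuous_on_subset)
  then have "open (S \<inter> (\<lambda>x. ?u x - v x) -` (- {0}))"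
    using \<open>open S\<close> by (intro continuous_open_preimage) auto
  then have o: "open {x \<in> S. ?u x \<noteq> v x}"
    by (rule arg_cong[THEN iffD1, rotated]) auto
  have "AE x in lebesgue. x \<in> S \<longrightarrow> ?u x = v x"
    using u(2) \<open>open S\<close> by (simp add: AE_restrict_space_iff)
  then have "{x \<in> S. ?u x \<noteq> v x} \<in> null_sets lebesgue"
    by (subst AE_iff_null_sets) (use o in \<open>auto simp: borel_open elim: eventually_mono\<close>)
  then have "{x \<in> S. ?u x \<noteq> v x} = {}"
    using open_not_negligible[OF o] negligible_iff_null_sets by blast
  then show ?thesis using \<open>x \<in> S\<close> by auto
qed

lemma pdiff_cong_open:
  assumes "f differentiable (at x)" "open S" "x \<in> S" "\<And>x. x \<in> S \<Longrightarrow> g x = f x"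
  shows "pdiff i g x = pdiff i f x"
  using frechet_derivative_transform_within_open[of f x S g] assms by (simp add: pdiff_def)

lemma C2_rep_derivatives:
  assumes "Ck_closure 2 UNIV v" "open S" "x \<in> S"
  shows "grad (C2_rep S v) x = grad v x" "laplacian (C2_rep S v) x = laplacian v x"
proof -
  have p: "pdiff i (C2_rep S v) y = pdiff i v y" if "y \<in> S" for i y
    using assms that by (intro pdiff_cong_open[of _ _ S]) (auto simp: C2_rep_eq C2_pdiff)
  then show "grad (C2_rep S v) x = grad v x"
    using assms by (simp add: grad_def)
  have "pdiff i (pdiff i (C2_rep S v)) x = pdiff i (pdiff i v) x" for i
    by (rule pdiff_cong_open[OF C2_pdiff(2)[OF assms(1)] assms(2,3) p])
  then show "laplacian (C2_rep S v) x = laplacian v x"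
    by (simp add: laplacian_def)
qed

lemma bdry_value_eq:
  assumes "continuous_on UNIV f" "open S" "x \<in> frontier S" "\<And>y. y \<in> S \<Longrightarrow> g y = f y"
  shows "bdry_value S g x = f x"
proof -
  \<comment> \<open>The point lies in the closure of the open set but not in the set itself. Being a
    limit point makes the filter nontrivial, so that \<open>Lim\<close> is determined.\<close>
  have "x islimpt S"
    using assms(2,3) by (auto simp: frontier_def interior_open closure_def)
  then have nt: "at x within S \<noteq> bot" by (simp add: trivial_limit_within)
  have "(f \<longlongrightarrow> f x) (at x within S)"
    using assms(1) by (meson UNIV_I continuous_on_def subset_UNIV tendsto_within_subset)
  moreover have "\<forall>\<^sub>F y in at x within S. f y = g y"
    using assms(4) by (simp add: eventually_at_filter)
  ultimately have "(g \<longlongrightarrow> f x) (at x within S)" by (rule Lim_transform_eventually)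
  then show ?thesis unfolding bdry_value_def by (rule tendsto_Lim[OF nt])
qed

section \<open>Integrals over the boundary of the cube\<close>

lemma cube_eq_box: "cube R = box (\<chi> i. - R) (\<chi> i. R)"
  by (auto simp: cube_def mem_box_cart)

lemma open_cube: "open (cube R)"
  by (simp add: cube_eq_box open_box)

text \<open>The comparison is restricted to the frontier, where boundary values are known; the
  parametrization of every face lands there.\<close>

lemma surface_nn_integral_mono:
  fixes f g :: "real^'n::finite \<Rightarrow> ennreal"
  assumes "R > 0" and le: "\<And>z. z \<in> frontier (cube R) \<Longrightarrow> f z \<le> g z"
  shows "surface_nn_integral R f \<le> surface_nn_integral R g"
  unfolding surface_nn_integral_def
proof (intro sum_mono nn_integral_mono le)
  fix i :: 'n and s y
  assume s: "s \<in> {- R, R}"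
    and y: "y \<in> space (Pi\<^sub>M (UNIV - {i}) (\<lambda>_. restrict_space lborel {- R..R}))"
  let ?z = "\<chi> j. if j = i then s else y j"
  have "cube R \<noteq> ({} :: (real^'n) set)"
    using \<open>R > 0\<close> by (auto simp: cube_def intro!: exI[of _ 0])
  then have c: "closure (cube R) = (cbox (\<chi> i. - R) (\<chi> i. R) :: (real^'n) set)"
    unfolding cube_eq_box by (rule closure_box)
  have "\<forall>j. j \<noteq> i \<longrightarrow> - R \<le> y j \<and> y j \<le> R"
    using y by (auto simp: space_PiM space_restrict_space PiE_def Pi_def)
  then have "?z \<in> closure (cube R)"
    unfolding c using s \<open>R > 0\<close> by (auto simp: mem_box_cart)
  moreover have "?z \<notin> cube R"
    using s by (auto simp: cube_def intro!: exI[of _ i])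
  ultimately show "?z \<in> frontier (cube R)"
    by (simp add: frontier_def interior_open open_cube)
qed

lemma weight_measurable [measurable]: "weight lam \<beta> x0 \<in> borel_measurable borel"
  unfolding weight_def[abs_def] by measurable

text \<open>The work lies in the measurability of the face embeddings, checked coordinate by
  coordinate: one coordinate is constant and the others are projections of the product
  space.\<close>

lemma surface_nn_integral_cmult:
  fixes f :: "real^'n::finite \<Rightarrow> ennreal"
  assumes [measurable]: "f \<in> borel_measurable borel"
  shows "surface_nn_integral R (\<lambda>x. c * f x) = c * surface_nn_integral R f"
proof -
  have [measurable]: "(\<lambda>y. \<chi> j. if j = i then s else y j)
      \<in> borel_measurable (Pi\<^sub>M (UNIV - {i}) (\<lambda>_. restrict_space lborel {- R..R}))" for i :: 'n and s
  proof -
    have "(\<lambda>y. if j = i then s else y j)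
        \<in> borel_measurable (Pi\<^sub>M (UNIV - {i}) (\<lambda>_. restrict_space lborel {- R..R}))" for j
    proof (cases "j = i")
      case False
      then have "(\<lambda>y. y j) \<in> (Pi\<^sub>M (UNIV - {i}) (\<lambda>_. restrict_space lborel {- R..R}))
          \<rightarrow>\<^sub>M restrict_space lborel {- R..R}"
        by (intro measurable_component_singleton) auto
      moreover have "(\<lambda>x. x) \<in> restrict_space lborel {- R..R} \<rightarrow>\<^sub>M borel"
        by (intro measurable_restrict_space1) simp
      ultimately show ?thesis using False measurable_compose by fastforce
    qed simp
    then show ?thesis
      by (subst borel_measurable_euclidean_space) (auto simp: Basis_vec_def inner_axis)
  qed
  show ?thesis
    unfolding surface_nn_integral_def sum_distrib_left by (simp add: nn_integral_cmult)
qed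

text \<open>The value and the gradient each contribute at most \<open>B\<^sup>2\<close>, whence the
  factor 2. The comparison is made in \<open>ennreal\<close>, so it also covers a point
  \<open>x0\<close> on the boundary, where the weight is infinite.\<close>

lemma boundary_energy_le:
  fixes v :: "real^'n::finite \<Rightarrow> real"
  assumes "Ck_closure 2 UNIV v" "R > 0"
    and small: "\<And>x. x \<in> frontier (cube R) \<Longrightarrow> \<bar>v x\<bar> < B \<and> norm (grad v x) < B"
  shows "boundary_energy R lam \<beta> x0 v \<le> ennreal (2 * B\<^sup>2) * surface_nn_integral R (weight lam \<beta> x0)"
proof -
  let ?u = "C2_rep (cube R) v"
  have "boundary_energy R lam \<beta> x0 v \<le> surface_nn_integral R (\<lambda>x. ennreal (2 * B\<^sup>2) * weight lam \<beta> x0 x)"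
    unfolding boundary_energy_def Let_def
  proof (rule surface_nn_integral_mono[OF \<open>R > 0\<close>])
    fix z :: "real^'n" assume z: "z \<in> frontier (cube R)"
    have "bdry_value (cube R) ?u z = v z"
      using C2_pdiff(3)[OF assms(1)] z assms by (intro bdry_value_eq open_cube) (auto simp: C2_rep_eq open_cube)
    moreover have "bdry_value (cube R) (grad ?u) z = grad v z"
      using grad_continuous[OF assms(1)] z assms
      by (intro bdry_value_eq open_cube) (auto simp: C2_rep_derivatives open_cube)
    moreover have "(v z)\<^sup>2 \<le> B\<^sup>2" "(norm (grad v z))\<^sup>2 \<le> B\<^sup>2"
      using small[OF z] by (auto simp: abs_le_square_iff[symmetric])
    ultimately have "(bdry_value (cube R) ?u z)\<^sup>2 + (norm (bdry_value (cube R) (grad ?u) z))\<^sup>2 \<le> 2 * B\<^sup>2"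
      by simp
    then show "weight lam \<beta> x0 z *
          ennreal ((bdry_value (cube R) ?u z)\<^sup>2 + (norm (bdry_value (cube R) (grad ?u) z))\<^sup>2)
        \<le> ennreal (2 * B\<^sup>2) * weight lam \<beta> x0 z"
      by (subst mult.commute) (intro mult_right_mono ennreal_leI, simp_all)
  qed
  then show ?thesis by (simp add: surface_nn_integral_cmult)
qed

text \<open>The equation transfers to the representative through its first and second derivatives on
  the open cube, so the residual is zero pointwise; in \<open>ennreal\<close> its product with any
  weight, even an infinite one, is zero.\<close>

lemma J_fun_solution:
  fixes v :: "real^'n::finite \<Rightarrow> real"
  assumes "Ck_closure 2 UNIV v" "\<And>x. - \<epsilon>0 * laplacian v x + F x (v x) (grad v x) = 0"
  shows "J_fun R p F \<epsilon>0 lam \<beta> x0 \<eta> v =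
    ennreal (lam ^ 4) * boundary_energy R lam \<beta> x0 v + ennreal (\<eta> * (Hnorm p (cube R) v)\<^sup>2)"
proof -
  let ?u = "C2_rep (cube R) v"
  have "(\<integral>\<^sup>+ x. weight lam \<beta> x0 x *
          ennreal ((- \<epsilon>0 * laplacian ?u x + F x (?u x) (grad ?u x))\<^sup>2) \<partial>lebesgue_on (cube R)) =
      (\<integral>\<^sup>+ x. 0 \<partial>lebesgue_on (cube R :: (real^'n) set))"
  proof (rule nn_integral_cong)
    fix x :: "real^'n" assume "x \<in> space (lebesgue_on (cube R))"
    then have "x \<in> cube R" by simp
    with assms show "weight lam \<beta> x0 x *
          ennreal ((- \<epsilon>0 * laplacian ?u x + F x (?u x) (grad ?u x))\<^sup>2) = 0"
      by (simp add: C2_rep_eq C2_rep_derivatives open_cube)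
  qed
  then show ?thesis by (simp add: J_fun_def Let_def)
qed

section \<open>The error estimate\<close>

lemma energy_le_functional:
  fixes F :: "real^'n::finite \<Rightarrow> real \<Rightarrow> real^'n \<Rightarrow> real"
  defines "A R p M \<equiv> Hclosure p (cube R) (Hball p (cube R) M)"
  assumes "C1 > 0" and v: "v \<in> A R p M"
    and D: "has_H_frechet_derivative p (cube R) (J_fun R p F \<epsilon>0 lam \<beta> x0 \<eta>) vmin (DJ vmin)"
    and conv: "convexity_inequality R p F \<epsilon>0 lam \<beta> x0 \<eta> DJ C1 v vmin"
    and min: "unique_minimizer (cube R) (A R p M) (J_fun R p F \<epsilon>0 lam \<beta> x0 \<eta>) vmin"
  shows "ennreal (min 1 C1) * (interior_energy R lam \<beta> x0 (\<lambda>x. v x - vmin x)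
        + ennreal (lam ^ 4) * boundary_energy R lam \<beta> x0 (\<lambda>x. v x - vmin x)
        + ennreal (\<eta> * (Hnorm p (cube R) (\<lambda>x. v x - vmin x))\<^sup>2))
      \<le> J_fun R p F \<epsilon>0 lam \<beta> x0 \<eta> v"
proof -
  let ?J = "J_fun R p F \<epsilon>0 lam \<beta> x0 \<eta>" and ?w = "\<lambda>x. v x - vmin x"
  let ?I = "interior_energy R lam \<beta> x0 ?w" and ?B = "ennreal (lam ^ 4) * boundary_energy R lam \<beta> x0 ?w"
    and ?N = "ennreal (\<eta> * (Hnorm p (cube R) ?w)\<^sup>2)"
  have "vmin \<in> A R p M" "\<And>u. u \<in> A R p M \<Longrightarrow> ?J vmin \<le> ?J u"
    using min by (auto simp: unique_minimizer_def)
  then have D0: "0 \<le> DJ vmin ?w"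
    using frechet_derivative_nonneg_at_minimizer[OF open_cube _ _ v _ D] by (simp add: A_def)
  \<comment> \<open>The convexity inequality has the coefficient \<open>C1\<close> on the two
    energies but 1 on the Sobolev term; the minimum is below both.\<close>
  have "ennreal (min 1 C1) * (?I + ?B + ?N) \<le> ennreal C1 * ?I + ennreal C1 * ?B + 1 * ?N"
    unfolding distrib_left by (intro add_mono mult_right_mono) (auto simp: ennreal_leI)
  also have "\<dots> \<le> ennreal (enn2real (?J v) - enn2real (?J vmin) - DJ vmin ?w)"
    using conv by (simp add: convexity_inequality_def Let_def)
  \<comment> \<open>Both subtracted terms are nonnegative: the value at the minimizer, and the
    derivative there in the direction of v.\<close>
  also have "\<dots> \<le> ennreal (enn2real (?J v))"
    using D0 enn2real_nonneg[of "?J vmin"] by (intro ennreal_leI) linarith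
  \<comment> \<open>Only an inequality, since an infinite value is turned into 0 by
    \<open>enn2real\<close>.\<close>
  also have "\<dots> \<le> ?J v"
    by (cases "?J v") auto
  finally show ?thesis .
qed

lemma ennreal_mult_le_imp:
  assumes "m > 0" "k \<ge> 0" "ennreal m * x \<le> ennreal k * y"
  shows "x \<le> ennreal (k / m) * y"
proof -
  have "x = ennreal (1 / m) * (ennreal m * x)"
    using assms by (simp add: mult.assoc[symmetric] ennreal_mult[symmetric])
  also have "\<dots> \<le> ennreal (1 / m) * (ennreal k * y)"
    using assms by (intro mult_left_mono) auto
  also have "\<dots> = ennreal (k / m) * y"
    using assms by (simp add: mult.assoc[symmetric] ennreal_mult[symmetric])
  finally show ?thesis .
qed

theorem theorem4p2:
  fixes C0 C1 :: real
  assumes "C0 > 0" and "C1 > 0"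
  shows "\<exists>C>0.
    \<forall>(R::real) (G::(real^'n::finite) set) (\<delta>::real) (c::real) (ch::real^'n \<Rightarrow> real)
      (H::real^'n \<Rightarrow> real^'n \<Rightarrow> real) (K::real) (k::real) (\<mu>::real)
      (F::real^'n \<Rightarrow> real \<Rightarrow> real^'n \<Rightarrow> real) (x0::real^'n) (p::nat) (M::real)
      (\<epsilon>0::real) (lam::real) (\<beta>::real) (\<eta>::real)
      (DJ::(real^'n \<Rightarrow> real) \<Rightarrow> (real^'n \<Rightarrow> real) \<Rightarrow> real)
      (v::real^'n \<Rightarrow> real) (vmin::real^'n \<Rightarrow> real).
      R > 0 \<longrightarrow>
      open G \<longrightarrow> connected G \<longrightarrow> G \<noteq> {} \<longrightarrow> bounded G \<longrightarrow> closure G \<subseteq> cube R \<longrightarrow>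
      0 < \<delta> \<longrightarrow> \<delta> < 1 \<longrightarrow>
      cutoff R G \<delta> c ch \<longrightarrow>
      K > 0 \<longrightarrow> k > 0 \<longrightarrow> (\<forall>x q. \<bar>H x q\<bar> \<le> K * norm q powr k) \<longrightarrow>
      \<mu> > 0 \<longrightarrow>
      F = HJ_F ch k \<mu> H \<longrightarrow>
      Ck_closure 2 UNIV (\<lambda>(x, s, q). F x s q) \<longrightarrow>
      x0 \<notin> cube R \<longrightarrow>
      int p > \<lceil>real CARD('n) / 2\<rceil> + 2 \<longrightarrow>
      M > 0 \<longrightarrow> \<epsilon>0 > 0 \<longrightarrow> lam > 0 \<longrightarrow> \<beta> > 0 \<longrightarrow> 0 < \<eta> \<longrightarrow> \<eta> < 1 \<longrightarrow>
      Ck_closure 2 UNIV v \<longrightarrow>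
      (\<forall>x. - \<epsilon>0 * laplacian v x + F x (v x) (grad v x) = 0) \<longrightarrow>
      (\<forall>x\<in>frontier (cube R). \<bar>v x\<bar> < C0 * \<delta> \<and> norm (grad v x) < C0 * \<delta>) \<longrightarrow>
      v \<in> Hclosure p (cube R) (Hball p (cube R) M) \<longrightarrow>
      (\<forall>w\<in>Hclosure p (cube R) (Hball p (cube R) M).
         has_H_frechet_derivative p (cube R) (J_fun R p F \<epsilon>0 lam \<beta> x0 \<eta>) w (DJ w)) \<longrightarrow>
      (\<forall>u\<in>Hclosure p (cube R) (Hball p (cube R) M).
         \<forall>w\<in>Hclosure p (cube R) (Hball p (cube R) M).
           convexity_inequality R p F \<epsilon>0 lam \<beta> x0 \<eta> DJ C1 u w) \<longrightarrow>
      unique_minimizer (cube R) (Hclosure p (cube R) (Hball p (cube R) M))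
        (J_fun R p F \<epsilon>0 lam \<beta> x0 \<eta>) vmin \<longrightarrow>
      interior_energy R lam \<beta> x0 (\<lambda>x. v x - vmin x)
        + ennreal (lam ^ 4) * boundary_energy R lam \<beta> x0 (\<lambda>x. v x - vmin x)
        + ennreal (\<eta> * (Hnorm p (cube R) (\<lambda>x. v x - vmin x))\<^sup>2)
      \<le> ennreal C *
          (ennreal (lam ^ 4 * \<delta>\<^sup>2) * surface_nn_integral R (weight lam \<beta> x0)
            + ennreal (\<eta> * (Hnorm p (cube R) v)\<^sup>2))"
proof (intro exI[of _ "max 1 (2 * C0\<^sup>2) / min 1 C1"] conjI allI impI)
  \<comment> \<open>The numerator bounds the coefficients 2 C0^2 of the boundary term and 1 of the
    Sobolev term in the functional at v; the denominator is the convexity constant from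
    \<open>energy_le_functional\<close>.\<close>
  show "0 < max 1 (2 * C0\<^sup>2) / min 1 C1" using assms by simp
  fix R :: real and G :: "(real^'n) set" and \<delta> c :: real and ch :: "real^'n \<Rightarrow> real"
    and H :: "real^'n \<Rightarrow> real^'n \<Rightarrow> real" and K k \<mu> :: real
    and F :: "real^'n \<Rightarrow> real \<Rightarrow> real^'n \<Rightarrow> real" and x0 :: "real^'n" and p :: nat
    and M \<epsilon>0 lam \<beta> \<eta> :: real
    and DJ :: "(real^'n \<Rightarrow> real) \<Rightarrow> (real^'n \<Rightarrow> real) \<Rightarrow> real"
    and v vmin :: "real^'n \<Rightarrow> real"
  let ?A = "Hclosure p (cube R) (Hball p (cube R) M)"
    and ?J = "J_fun R p F \<epsilon>0 lam \<beta> x0 \<eta>" and ?K = "max 1 (2 * C0\<^sup>2)"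
    and ?S = "surface_nn_integral R (weight lam \<beta> x0)"
    and ?N = "ennreal (\<eta> * (Hnorm p (cube R) v)\<^sup>2)"
  assume R: "R > 0" and C2: "Ck_closure 2 UNIV v"
    and pde: "\<forall>x. - \<epsilon>0 * laplacian v x + F x (v x) (grad v x) = 0"
    and small: "\<forall>x\<in>frontier (cube R). \<bar>v x\<bar> < C0 * \<delta> \<and> norm (grad v x) < C0 * \<delta>"
    and v: "v \<in> ?A"
    and D: "\<forall>w\<in>?A. has_H_frechet_derivative p (cube R) ?J w (DJ w)"
    and conv: "\<forall>u\<in>?A. \<forall>w\<in>?A. convexity_inequality R p F \<epsilon>0 lam \<beta> x0 \<eta> DJ C1 u w"
    and min: "unique_minimizer (cube R) ?A ?J vmin"
  have vmin: "vmin \<in> ?A" using min by (simp add: unique_minimizer_def)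
  have "ennreal (min 1 C1) * (interior_energy R lam \<beta> x0 (\<lambda>x. v x - vmin x)
        + ennreal (lam ^ 4) * boundary_energy R lam \<beta> x0 (\<lambda>x. v x - vmin x)
        + ennreal (\<eta> * (Hnorm p (cube R) (\<lambda>x. v x - vmin x))\<^sup>2)) \<le> ?J v"
    using assms(2) v D conv min vmin by (intro energy_le_functional) auto
  also have "?J v = ennreal (lam ^ 4) * boundary_energy R lam \<beta> x0 v + ?N"
    using C2 pde by (intro J_fun_solution) auto
  also have "\<dots> \<le> ennreal (lam ^ 4) * (ennreal (2 * (C0 * \<delta>)\<^sup>2) * ?S) + 1 * ?N"
    using C2 R small by (intro add_mono mult_left_mono boundary_energy_le) auto
  also have "ennreal (lam ^ 4) * (ennreal (2 * (C0 * \<delta>)\<^sup>2) * ?S) =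
      ennreal (2 * C0\<^sup>2) * (ennreal (lam ^ 4 * \<delta>\<^sup>2) * ?S)"
  proof -
    have "lam ^ 4 * (2 * (C0 * \<delta>)\<^sup>2) = 2 * C0\<^sup>2 * (lam ^ 4 * \<delta>\<^sup>2)"
      unfolding power_mult_distrib by simp
    then have "ennreal (lam ^ 4) * ennreal (2 * (C0 * \<delta>)\<^sup>2) = ennreal (2 * C0\<^sup>2) * ennreal (lam ^ 4 * \<delta>\<^sup>2)"
      by (subst (1 2) ennreal_mult[symmetric]) simp_all
    then show ?thesis by (simp only: mult.assoc[symmetric, where c = ?S])
  qed
  \<comment> \<open>Both coefficients are enlarged to their maximum, which can then be factored
    out.\<close>
  also have "\<dots> + 1 * ?N \<le> ennreal ?K * (ennreal (lam ^ 4 * \<delta>\<^sup>2) * ?S) + ennreal ?K * ?N"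
    unfolding ennreal_1[symmetric] by (intro add_mono mult_right_mono ennreal_leI) auto
  also have "\<dots> = ennreal ?K * (ennreal (lam ^ 4 * \<delta>\<^sup>2) * ?S + ?N)"
    by (rule distrib_left[symmetric])
  finally show "interior_energy R lam \<beta> x0 (\<lambda>x. v x - vmin x)
        + ennreal (lam ^ 4) * boundary_energy R lam \<beta> x0 (\<lambda>x. v x - vmin x)
        + ennreal (\<eta> * (Hnorm p (cube R) (\<lambda>x. v x - vmin x))\<^sup>2)
      \<le> ennreal (?K / min 1 C1) * (ennreal (lam ^ 4 * \<delta>\<^sup>2) * ?S + ?N)"
    using assms(2) by (intro ennreal_mult_le_imp) auto
qed

end
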